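(* Let $\lambda\in\mathbb{C}^*$, $\beta(y)\in\mathbb{C}[y]$, $b\in\mathbb{C}$, and assume $g(y),g'(y)\in\mathbb{C}[y]$ with $g(y)=(y-b)g'(y)$. Let $\Psi_{\mathfrak{hv}}(\lambda,\beta)=\mathbb{C}[x,y]$ be the associated module over the Heisenberg-Virasoro algebra $\mathfrak{hv}$, with submodules $R_g^{\mathfrak{hv}}=g(y)\mathbb{C}[x,y]$ and $R_{g'}^{\mathfrak{hv}}=g'(y)\mathbb{C}[x,y]$. Then, as $\mathfrak{hv}$-modules, $R_{g'}^{\mathfrak{hv}}/R_g^{\mathfrak{hv}}\cong\Phi_{\mathfrak{hv}}(\lambda,\beta,b)$. If $(b,\beta(b))\neq(0,0)$, the quotient module is irreducible.
   Context: All vector spaces are over $\mathbb{C}$; $\mathbb{C}^*$ is the set of nonzero complex numbers. The Heisenberg-Virasoro algebra $\mathfrak{hv}$ is the Lie algebra with basis $L_m,H_m$ ($m\in\mathbb{Z}$), $C_1,C_2,C_3$ and brackets $[L_m,L_n]=(m-n)L_{m+n}+\delta_{m+n,0}\frac{m^3-m}{12}C_1$, $[L_m,H_n]=-nH_{m+n}+\delta_{m+n,0}(m^2+m)C_2$, $[H_m,H_n]=m\delta_{m+n,0}C_3$, with $C_1,C_2,C_3$ central. $\Psi_{\mathfrak{hv}}(\lambda,\beta)=\mathbb{C}[x,y]$ is the $\mathfrak{hv}$-module with actions $L_mf(x,y)=\lambda^m(x+m\beta(y))f(x+m,y)$, $H_mf(x,y)=\lambda^myf(x+m,y)$, $C_if(x,y)=0$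 for $f\in\mathbb{C}[x,y]$, $m\in\mathbb{Z}$, $i=1,2,3$. $\Phi_{\mathfrak{hv}}(\lambda,\beta,b)=\mathbb{C}[x]$ is the $\mathfrak{hv}$-module with actions $L_mf(x)=\lambda^m(x+m\beta(b))f(x+m)$, $H_mf(x)=\lambda^mbf(x+m)$, $C_if(x)=0$ for $f\in\mathbb{C}[x]$, $m\in\mathbb{Z}$, $i=1,2,3$.
   Formalization: The polynomial g'(y) is assumed to be nonzero; for g' = 0 both submodules are zero, so the quotient is zero and is neither isomorphic to Φ(λ,β,b) = C[x] nor irreducible. *)

theory Defs
  imports
    Complex_Main
    "HOL-Library.Poly_Mapping"
    "HOL-Computational_Algebra.Polynomial"
    "HOL-Algebra.Algebraic_Closure_Type"
begin

section \<open>Lie algebras and their modules\<close>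

locale lie_algebra = vector_space scale
  for scale :: "'k::field \<Rightarrow> 'g::ab_group_add \<Rightarrow> 'g" +
  fixes bracket :: "'g \<Rightarrow> 'g \<Rightarrow> 'g"
  assumes bracket_add_left: "bracket (u + v) w = bracket u w + bracket v w"
    and bracket_add_right: "bracket u (v + w) = bracket u v + bracket u w"
    and bracket_scale_left: "bracket (scale c u) v = scale c (bracket u v)"
    and bracket_scale_right: "bracket u (scale c v) = scale c (bracket u v)"
    and bracket_self: "bracket u u = 0"
    and jacobi: "bracket u (bracket v w) + bracket v (bracket w u) + bracket w (bracket u v) = 0"

text \<open>
  The carrier, addition and scalar multiplication of a Lie algebra module are those of the
  HOL-Algebra record for modules.  That record extends rings, so it also has fields \<open>mult\<close> and
  \<open>one\<close>; they are irrelevant for modules and are set to \<open>undefined\<close> below.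
\<close>

record ('k, 'g, 'v) lie_module = "('k, 'v) module" +
  act :: "'g \<Rightarrow> 'v \<Rightarrow> 'v"

locale lie_module =
  lie_algebra scale bracket + Module.module "ring_of_type_algebra :: 'k ring" M
  for scale :: "'k::field \<Rightarrow> 'g::ab_group_add \<Rightarrow> 'g" and bracket :: "'g \<Rightarrow> 'g \<Rightarrow> 'g"
    and M :: "('k, 'g, 'v, 'm) lie_module_scheme" +
  assumes act_closed: "x \<in> carrier M \<Longrightarrow> act M u x \<in> carrier M"
    and act_add_right: "x \<in> carrier M \<Longrightarrow> y \<in> carrier M \<Longrightarrow>
      act M u (x \<oplus>\<^bsub>M\<^esub> y) = act M u x \<oplus>\<^bsub>M\<^esub> act M u y"
    and act_smult_right: "x \<in> carrier M \<Longrightarrow> act M u (c \<odot>\<^bsub>M\<^esub> x) = c \<odot>\<^bsub>M\<^esub> act M u x"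
    and act_add_left: "x \<in> carrier M \<Longrightarrow> act M (u + v) x = act M u x \<oplus>\<^bsub>M\<^esub> act M v x"
    and act_scale_left: "x \<in> carrier M \<Longrightarrow> act M (scale c u) x = c \<odot>\<^bsub>M\<^esub> act M u x"
    and act_bracket: "x \<in> carrier M \<Longrightarrow>
      act M (bracket u v) x = act M u (act M v x) \<ominus>\<^bsub>M\<^esub> act M v (act M u x)"

definition lie_submodule :: "'v set \<Rightarrow> ('k::field, 'g, 'v, 'm) lie_module_scheme \<Rightarrow> bool" where
  "lie_submodule N M \<longleftrightarrow>
     submodule N (ring_of_type_algebra :: 'k ring) M \<and> (\<forall>u. \<forall>x\<in>N. act M u x \<in> N)"

text \<open>
  The quotient of \<open>M\<close> by a submodule \<open>N\<close>, realised on the additive cosets of \<open>N\<close>.  If \<open>A\<close> is the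
  coset of \<open>x\<close>, then \<open>\<Union>x\<in>A. N +>\<^bsub>M\<^esub> act M u x\<close> is the coset of \<open>act M u x\<close>; likewise for scalars.
\<close>

definition lie_quotient ::
  "('k, 'g, 'v, 'm) lie_module_scheme \<Rightarrow> 'v set \<Rightarrow> ('k, 'g, 'v set) lie_module" where
  "lie_quotient M N =
     \<lparr> carrier = a_rcosets\<^bsub>M\<^esub> N, monoid.mult = undefined, one = undefined,
       zero = N, add = set_add M,
       module.smult = (\<lambda>c A. \<Union>x\<in>A. N +>\<^bsub>M\<^esub> (c \<odot>\<^bsub>M\<^esub> x)),
       act = (\<lambda>u A. \<Union>x\<in>A. N +>\<^bsub>M\<^esub> act M u x) \<rparr>"

definition lie_module_iso ::
  "('k, 'g, 'v, 'm) lie_module_scheme \<Rightarrow> ('k, 'g, 'w, 'n) lie_module_scheme \<Rightarrow> ('v \<Rightarrow> 'w) set" where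
  "lie_module_iso M N =
     {f \<in> iso (add_monoid M) (add_monoid N).
        (\<forall>c. \<forall>x\<in>carrier M. f (c \<odot>\<^bsub>M\<^esub> x) = c \<odot>\<^bsub>N\<^esub> f x) \<and>
        (\<forall>u. \<forall>x\<in>carrier M. f (act M u x) = act N u (f x))}"

definition lie_isomorphic ::
  "('k::field \<Rightarrow> 'g::ab_group_add \<Rightarrow> 'g) \<Rightarrow> ('g \<Rightarrow> 'g \<Rightarrow> 'g) \<Rightarrow>
   ('k, 'g, 'v, 'm) lie_module_scheme \<Rightarrow> ('k, 'g, 'w, 'n) lie_module_scheme \<Rightarrow> bool" where
  "lie_isomorphic scale bracket M N \<longleftrightarrow>
     lie_module scale bracket M \<and> lie_module scale bracket N \<and> lie_module_iso M N \<noteq> {}"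

definition lie_irreducible ::
  "('k::field \<Rightarrow> 'g::ab_group_add \<Rightarrow> 'g) \<Rightarrow> ('g \<Rightarrow> 'g \<Rightarrow> 'g) \<Rightarrow>
   ('k, 'g, 'v, 'm) lie_module_scheme \<Rightarrow> bool" where
  "lie_irreducible scale bracket M \<longleftrightarrow>
     lie_module scale bracket M \<and> carrier M \<noteq> {\<zero>\<^bsub>M\<^esub>} \<and>
     (\<forall>N. lie_submodule N M \<longrightarrow> N = {\<zero>\<^bsub>M\<^esub>} \<or> N = carrier M)"

definition lie_module_on_type ::
  "('k \<Rightarrow> 'v::ab_group_add \<Rightarrow> 'v) \<Rightarrow> ('g \<Rightarrow> 'v \<Rightarrow> 'v) \<Rightarrow> ('k, 'g, 'v) lie_module" where
  "lie_module_on_type scale_v action =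
     \<lparr> carrier = UNIV, monoid.mult = undefined, one = undefined, zero = 0, add = (+),
       module.smult = scale_v, act = action \<rparr>"


section \<open>The Heisenberg-Virasoro algebra\<close>

datatype hv_basis = hv_L int | hv_H int | hv_C1 | hv_C2 | hv_C3

type_synonym hv = "hv_basis \<Rightarrow>\<^sub>0 complex"

definition hv_scale :: "complex \<Rightarrow> hv \<Rightarrow> hv" where
  "hv_scale c = Poly_Mapping.map ((*) c)"

text \<open>The linear extension of a map given on the basis.\<close>

definition lin_ext ::
  "(complex \<Rightarrow> 'v \<Rightarrow> 'v) \<Rightarrow> (hv_basis \<Rightarrow> 'v) \<Rightarrow> hv \<Rightarrow> 'v::ab_group_add" where
  "lin_ext scale_v f u =
     (\<Sum>a\<in>Poly_Mapping.keys u. scale_v (Poly_Mapping.lookup u a) (f a))"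

text \<open>The value on \<open>(H\<^sub>m, L\<^sub>n)\<close> is minus the one on \<open>(L\<^sub>n, H\<^sub>m)\<close>.\<close>

fun hv_basis_bracket :: "hv_basis \<Rightarrow> hv_basis \<Rightarrow> hv" where
  "hv_basis_bracket (hv_L m) (hv_L n) =
     Poly_Mapping.single (hv_L (m + n)) (of_int (m - n)) +
     (if m + n = 0 then Poly_Mapping.single hv_C1 (of_int (m ^ 3 - m) / 12) else 0)"
| "hv_basis_bracket (hv_L m) (hv_H n) =
     Poly_Mapping.single (hv_H (m + n)) (- of_int n) +
     (if m + n = 0 then Poly_Mapping.single hv_C2 (of_int (m ^ 2 + m)) else 0)"
| "hv_basis_bracket (hv_H m) (hv_L n) =
     Poly_Mapping.single (hv_H (m + n)) (of_int m) -
     (if m + n = 0 then Poly_Mapping.single hv_C2 (of_int (n ^ 2 + n)) else 0)"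
| "hv_basis_bracket (hv_H m) (hv_H n) =
     (if m + n = 0 then Poly_Mapping.single hv_C3 (of_int m) else 0)"
| "hv_basis_bracket _ _ = 0"

definition hv_bracket :: "hv \<Rightarrow> hv \<Rightarrow> hv" where
  "hv_bracket u v = lin_ext hv_scale (\<lambda>a. lin_ext hv_scale (hv_basis_bracket a) v) u"

abbreviation hv_isomorphic where
  "hv_isomorphic \<equiv> lie_isomorphic hv_scale hv_bracket"

abbreviation hv_irreducible where
  "hv_irreducible \<equiv> lie_irreducible hv_scale hv_bracket"


section \<open>The modules \<open>\<Psi>\<close> and \<open>\<Phi>\<close>\<close>

text \<open>
  \<open>\<complex>[x,y]\<close> is \<open>complex poly poly\<close> with outer variable \<open>x\<close> and coefficients in \<open>\<complex>[y]\<close>.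
  Thus \<open>x = [:0, 1:]\<close>, a polynomial \<open>p(y)\<close> is the constant \<open>[:p:]\<close>, \<open>f(x + m, y)\<close> is
  \<open>pcompose f [:of_int m, 1:]\<close>, and a scalar \<open>c\<close> acts by \<open>Polynomial.smult [:c:]\<close>.
\<close>

definition scale_xy :: "complex \<Rightarrow> complex poly poly \<Rightarrow> complex poly poly" where
  "scale_xy c = Polynomial.smult [:c:]"

fun Psi_basis_act ::
  "complex \<Rightarrow> complex poly \<Rightarrow> hv_basis \<Rightarrow> complex poly poly \<Rightarrow> complex poly poly" where
  "Psi_basis_act lam \<beta> (hv_L m) f =
     scale_xy (lam powi m) (([:0, 1:] + of_int m * [:\<beta>:]) * pcompose f [:of_int m, 1:])"
| "Psi_basis_act lam \<beta> (hv_H m) f =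
     scale_xy (lam powi m) ([:[:0, 1:]:] * pcompose f [:of_int m, 1:])"
| "Psi_basis_act _ _ _ _ = 0"

definition Psi :: "complex \<Rightarrow> complex poly \<Rightarrow> (complex, hv, complex poly poly) lie_module" where
  "Psi lam \<beta> = lie_module_on_type scale_xy
     (\<lambda>u f. lin_ext scale_xy (\<lambda>a. Psi_basis_act lam \<beta> a f) u)"

fun Phi_basis_act ::
  "complex \<Rightarrow> complex poly \<Rightarrow> complex \<Rightarrow> hv_basis \<Rightarrow> complex poly \<Rightarrow> complex poly" where
  "Phi_basis_act lam \<beta> b (hv_L m) f =
     Polynomial.smult (lam powi m) (([:0, 1:] + of_int m * [:poly \<beta> b:]) * pcompose f [:of_int m, 1:])"
| "Phi_basis_act lam \<beta> b (hv_H m) f =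
     Polynomial.smult (lam powi m) ([:b:] * pcompose f [:of_int m, 1:])"
| "Phi_basis_act _ _ _ _ _ = 0"

definition Phi ::
  "complex \<Rightarrow> complex poly \<Rightarrow> complex \<Rightarrow> (complex, hv, complex poly) lie_module" where
  "Phi lam \<beta> b = lie_module_on_type Polynomial.smult
     (\<lambda>u f. lin_ext Polynomial.smult (\<lambda>a. Phi_basis_act lam \<beta> b a f) u)"

text \<open>\<open>g(y) \<complex>[x,y]\<close>\<close>

definition R_sub :: "complex poly \<Rightarrow> complex poly poly set" where
  "R_sub g = {[:g:] * f | f. True}"

definition Psi_sub ::
  "complex \<Rightarrow> complex poly \<Rightarrow> complex poly \<Rightarrow> (complex, hv, complex poly poly) lie_module" where
  "Psi_sub lam \<beta> g = (Psi lam \<beta>)\<lparr>carrier := R_sub g\<rparr>"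


section \<open>The above are a Lie algebra, modules and submodules\<close>


lemma lookup_hv_scale [simp]: "Poly_Mapping.lookup (hv_scale c u) a = c * Poly_Mapping.lookup u a"
  unfolding hv_scale_def by (simp add: Poly_Mapping.map.rep_eq when_def)

lemma vector_space_hv: "vector_space hv_scale"
  by unfold_locales (auto intro!: poly_mapping_eqI simp: lookup_add algebra_simps)

lemma hv_scale_single: "hv_scale c (Poly_Mapping.single a d) = Poly_Mapping.single a (c * d)"
  by (rule poly_mapping_eqI) (simp add: lookup_single when_def)

context
  fixes s :: "complex \<Rightarrow> 'v::ab_group_add \<Rightarrow> 'v"
  assumes vs: "vector_space s"
begin

interpretation vector_space s by (rule vs)

lemma lin_ext_superset:
  assumes "finite S" "Poly_Mapping.keys u \<subseteq> S"
  shows "lin_ext s f u = (\<Sum>a\<in>S. s (Poly_Mapping.lookup u a) (f a))"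
  unfolding lin_ext_def using assms
  by (intro sum.mono_neutral_left) (auto simp: in_keys_iff)

lemma lin_ext_add: "lin_ext s f (u + v) = lin_ext s f u + lin_ext s f v"
proof -
  let ?S = "Poly_Mapping.keys u \<union> Poly_Mapping.keys v"
  have "lin_ext s f (u + v) = (\<Sum>a\<in>?S. s (Poly_Mapping.lookup (u + v) a) (f a))"
    by (rule lin_ext_superset) (use Poly_Mapping.keys_add[of u v] in auto)
  also have "\<dots> = (\<Sum>a\<in>?S. s (Poly_Mapping.lookup u a) (f a)) + (\<Sum>a\<in>?S. s (Poly_Mapping.lookup v a) (f a))"
    by (simp add: lookup_add scale_left_distrib sum.distrib)
  also have "\<dots> = lin_ext s f u + lin_ext s f v"
    by (simp add: lin_ext_superset[symmetric])
  finally show ?thesis .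
qed

lemma lin_ext_zero: "lin_ext s f 0 = 0" by (simp add: lin_ext_def)

lemma lin_ext_scale: "lin_ext s f (hv_scale c u) = s c (lin_ext s f u)"
proof -
  have "lin_ext s f (hv_scale c u) = (\<Sum>a\<in>Poly_Mapping.keys u. s (Poly_Mapping.lookup (hv_scale c u) a) (f a))"
    by (rule lin_ext_superset) (auto simp: in_keys_iff)
  also have "\<dots> = s c (lin_ext s f u)"
    by (simp add: lin_ext_def scale_sum_right)
  finally show ?thesis .
qed

lemma lin_ext_single: "lin_ext s f (Poly_Mapping.single a c) = s c (f a)"
  by (subst lin_ext_superset[of "{a}"]) auto

lemma lin_ext_add_fun: "lin_ext s (\<lambda>a. f a + g a) u = lin_ext s f u + lin_ext s g u"
  by (simp add: lin_ext_def scale_right_distrib sum.distrib)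

lemma lin_ext_scale_fun: "lin_ext s (\<lambda>a. s c (f a)) u = s c (lin_ext s f u)"
  by (simp add: lin_ext_def scale_sum_right mult.commute)

lemma lin_ext_diff: "lin_ext s f (u - v) = lin_ext s f u - lin_ext s f v"
  using lin_ext_add[of f "u - v" v] by simp

lemma lin_ext_uminus: "lin_ext s f (- v) = - lin_ext s f v"
  using lin_ext_add[of f "v" "-v"] by (simp add: lin_ext_zero eq_neg_iff_add_eq_0 add.commute)

lemma lin_ext_in:
  assumes "0 \<in> N" "\<And>x y. x \<in> N \<Longrightarrow> y \<in> N \<Longrightarrow> x + y \<in> N" "\<And>c x. x \<in> N \<Longrightarrow> s c x \<in> N" "\<And>a. f a \<in> N"
  shows "lin_ext s f u \<in> N"
proof -
  have "finite A \<Longrightarrow> (\<Sum>a\<in>A. s (Poly_Mapping.lookup u a) (f a)) \<in> N" for A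
    by (induction A rule: finite_induct) (auto intro: assms)
  then show ?thesis by (simp add: lin_ext_def)
qed

end

lemma hv_induct [case_names zero basis scale add]:
  fixes u :: hv
  assumes z: "P 0" and b: "\<And>a. P (Poly_Mapping.single a 1)"
    and s: "\<And>c u. P u \<Longrightarrow> P (hv_scale c u)"
    and a: "\<And>u v. P u \<Longrightarrow> P v \<Longrightarrow> P (u + v)"
  shows "P u"
proof (induction u rule: update_induct)
  case const then show ?case by (rule z)
next
  case (update f a c)
  have "Poly_Mapping.update a c f = f + hv_scale c (Poly_Mapping.single a 1)"
    using update by (intro poly_mapping_eqI) (auto simp: lookup_update lookup_add lookup_single when_def in_keys_iff)
  then show ?case using update a s b by simp
qed

lemma hv_bracket_single: "hv_bracket (Poly_Mapping.single a 1) (Poly_Mapping.single b 1) = hv_basis_bracket a b"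
proof -
  interpret vector_space hv_scale by (rule vector_space_hv)
  show ?thesis by (simp add: hv_bracket_def lin_ext_single[OF vector_space_hv])
qed

lemmas hv_lin = lin_ext_add[OF vector_space_hv] lin_ext_scale[OF vector_space_hv]
  lin_ext_add_fun[OF vector_space_hv] lin_ext_scale_fun[OF vector_space_hv] lin_ext_zero[OF vector_space_hv]

lemma hv_bracket_bilinear:
  "hv_bracket (u + v) w = hv_bracket u w + hv_bracket v w"
  "hv_bracket u (v + w) = hv_bracket u v + hv_bracket u w"
  "hv_bracket (hv_scale c u) v = hv_scale c (hv_bracket u v)"
  "hv_bracket u (hv_scale c v) = hv_scale c (hv_bracket u v)"
  by (simp_all add: hv_bracket_def hv_lin)

lemma hv_bracket_zero: "hv_bracket 0 u = 0" "hv_bracket u 0 = 0"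
  using hv_bracket_bilinear(1)[of 0 0 u] hv_bracket_bilinear(2)[of u 0 0] by auto

lemma hv_bracket_minus: "hv_bracket (u - v) w = hv_bracket u w - hv_bracket v w"
  "hv_bracket w (u - v) = hv_bracket w u - hv_bracket w v"
  using hv_bracket_bilinear(1)[of "u - v" v w] hv_bracket_bilinear(2)[of w "u - v" v] by auto

lemma hv_skew: "hv_bracket u v = - hv_bracket v u"
proof -
  interpret vector_space hv_scale by (rule vector_space_hv)
  show ?thesis
  proof (induction u rule: hv_induct)
    case (basis a)
    show ?case
    proof (induction v rule: hv_induct)
      case (basis b)
      show ?case unfolding hv_bracket_single
        by (cases a; cases b; 
            auto intro!: poly_mapping_eqI simp: lookup_add lookup_single lookup_minus when_def algebra_simps)
          (auto simp: eq_neg_iff_add_eq_0 [symmetric] add_eq_0_iff power3_eq_cube power2_eq_square algebra_simps)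
    qed (auto simp: hv_bracket_bilinear hv_bracket_zero)
  qed (auto simp: hv_bracket_bilinear hv_bracket_zero)
qed


lemma hv_bracket_single': "hv_bracket (Poly_Mapping.single a c) (Poly_Mapping.single b d) = hv_scale (c * d) (hv_basis_bracket a b)"
proof -
  interpret vector_space hv_scale by (rule vector_space_hv)
  show ?thesis by (simp add: hv_bracket_def lin_ext_single[OF vector_space_hv])
qed

lemma hv_scale_zero: "hv_scale c 0 = 0" by (rule poly_mapping_eqI) simp

lemma sum3: "a + (b + c) = (0::int) \<Longrightarrow> complex_of_int a = - of_int b - of_int c"
  by (metis add.commute add_eq_0_iff diff_conv_add_uminus minus_add_distrib of_int_add of_int_minus)

lemma hv_jacobi: "hv_bracket u (hv_bracket v w) + hv_bracket v (hv_bracket w u) + hv_bracket w (hv_bracket u v) = 0"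
  (is "?J u v w = 0")
proof -
  interpret vector_space hv_scale by (rule vector_space_hv)
  note bl = hv_bracket_bilinear hv_bracket_zero hv_bracket_minus
  have 1: "?J (u + u') v w = ?J u v w + ?J u' v w" "?J u (v + v') w = ?J u v w + ?J u v' w"
    "?J u v (w + w') = ?J u v w + ?J u v w'" for u u' v v' w w' by (simp_all add: bl algebra_simps)
  have 2: "?J (hv_scale c u) v w = hv_scale c (?J u v w)" "?J u (hv_scale c v) w = hv_scale c (?J u v w)"
    "?J u v (hv_scale c w) = hv_scale c (?J u v w)" for u v w c by (simp_all add: bl scale_right_distrib)
  have 3: "?J 0 v w = 0" "?J u 0 w = 0" "?J u v 0 = 0" for u v w by (simp_all add: bl)
  have b: "?J (Poly_Mapping.single x 1) (Poly_Mapping.single y 1) (Poly_Mapping.single z 1) = 0" for x y z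
    unfolding hv_bracket_single
    apply (cases x; cases y; cases z)
    apply (simp_all add: bl hv_bracket_single' hv_scale_zero if_distrib[of "hv_bracket _"] if_distrib[of "hv_scale _"] cong: if_cong)
    apply (auto intro!: poly_mapping_eqI simp: lookup_add lookup_single lookup_minus when_def algebra_simps)
    apply (drule sum3; simp only: of_int_add of_int_0; simp add: field_simps power2_eq_square power3_eq_cube)+
    done
  show ?thesis
  proof (induction u rule: hv_induct)
    case (basis x)
    show ?case
    proof (induction v rule: hv_induct)
      case (basis y)
      show ?case
        by (induction w rule: hv_induct) (simp_all only: 1 2 3 b scale_zero_right add_0_left)
    qed (simp_all only: 1 2 3 scale_zero_right add_0_left)
  qed (simp_all only: 1 2 3 scale_zero_right add_0_left)
qed

lemma hv_bracket_self: "hv_bracket u u = 0"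
proof (rule poly_mapping_eqI)
  fix k
  have "Poly_Mapping.lookup (hv_bracket u u) k = - Poly_Mapping.lookup (hv_bracket u u) k"
    using hv_skew[of u u] by (metis lookup_uminus)
  then show "Poly_Mapping.lookup (hv_bracket u u) k = Poly_Mapping.lookup 0 k" by simp
qed

lemma hv_lie_algebra: "lie_algebra hv_scale hv_bracket"
  by (intro lie_algebra.intro vector_space_hv lie_algebra_axioms.intro hv_bracket_bilinear
      hv_bracket_self hv_jacobi)

lemma lie_module_on_typeI:
  assumes vs: "vector_space s"
    and F: "\<And>a x y. F a (x + y) = F a x + F a y" "\<And>a c x. F a (s c x) = s c (F a x)"
    and br: "\<And>a b x. lin_ext s (\<lambda>k. F k x) (hv_basis_bracket a b) = F a (F b x) - F b (F a x)"
  shows "lie_module hv_scale hv_bracket (lie_module_on_type s (\<lambda>u x. lin_ext s (\<lambda>a. F a x) u))"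
proof -
  let ?A = "\<lambda>u x. lin_ext s (\<lambda>a. F a x) u"
  let ?M = "lie_module_on_type s ?A"
  interpret vector_space s by (rule vs)
  have sm: "carrier ?M = UNIV" "zero ?M = 0" "add ?M = (+)" "module.smult ?M = s" "act ?M = ?A"
    by (simp_all add: lie_module_on_type_def)
  have ag: "abelian_group ?M"
  proof (rule abelian_groupI)
    fix x assume "x \<in> carrier ?M"
    show "\<exists>y\<in>carrier ?M. y \<oplus>\<^bsub>?M\<^esub> x = \<zero>\<^bsub>?M\<^esub>" by (rule bexI[of _ "-x"]) (auto simp: sm)
  qed (auto simp: sm algebra_simps)
  interpret M: abelian_group ?M by (rule ag)
  have mn: "x \<ominus>\<^bsub>?M\<^esub> y = x - y" for x y
  proof -
    have "(\<ominus>\<^bsub>?M\<^esub> y) + y = 0" using M.l_neg[of y] by (simp add: sm)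
    then have "\<ominus>\<^bsub>?M\<^esub> y = - y" by (simp add: eq_neg_iff_add_eq_0)
    then show ?thesis by (simp add: a_minus_def sm)
  qed
  have mod: "Module.module ring_of_type_algebra ?M"
    by (rule Module.moduleI[OF cring_from_type_algebra ag])
       (simp_all add: sm ring_of_type_algebra_def scale_left_distrib scale_right_distrib)
  note l = lin_ext_add[OF vs] lin_ext_scale[OF vs] lin_ext_single[OF vs] lin_ext_zero[OF vs]
     lin_ext_add_fun[OF vs] lin_ext_scale_fun[OF vs]
  have A: "?A u (x + y) = ?A u x + ?A u y" "?A u (s c x) = s c (?A u x)" for u x y c
    by (simp_all add: F l)
  then have A0: "?A u 0 = 0" for u using A(1)[of 0 0 u] by simp
  have bb: "?A (hv_bracket u v) x = ?A u (?A v x) - ?A v (?A u x)" for u v x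
  proof (induction u rule: hv_induct)
    case (basis a)
    show ?case
    proof (induction v rule: hv_induct)
      case (basis b)
      show ?case by (simp add: hv_bracket_single br l)
    qed (simp_all add: hv_bracket_bilinear hv_bracket_zero l A A0 scale_right_diff_distrib)
  qed (simp_all add: hv_bracket_bilinear hv_bracket_zero l A A0 scale_right_diff_distrib)
  show ?thesis
    by (intro lie_module.intro hv_lie_algebra mod lie_module_axioms.intro)
       (simp_all only: sm mn bb A l, simp_all)
qed

lemma shift_shift: "pcompose (pcompose (f::'a::comm_ring_1 poly) [:of_int m, 1:]) [:of_int n, 1:] = pcompose f [:of_int (m + n), 1:]"
  by (simp add: pcompose_assoc[symmetric] pcompose_pCons add_ac)

text \<open>The common form of the two actions: \<open>e\<close> embeds the scalars into the coefficient ring.\<close>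

fun shift_act ::
  "(complex \<Rightarrow> 'a::comm_ring_1) \<Rightarrow> complex \<Rightarrow> 'a \<Rightarrow> 'a \<Rightarrow> hv_basis \<Rightarrow> 'a poly \<Rightarrow> 'a poly" where
  "shift_act e lam \<beta> y (hv_L m) f =
     Polynomial.smult (e (lam powi m)) (([:0, 1:] + of_int m * [:\<beta>:]) * pcompose f [:of_int m, 1:])"
| "shift_act e lam \<beta> y (hv_H m) f =
     Polynomial.smult (e (lam powi m)) ([:y:] * pcompose f [:of_int m, 1:])"
| "shift_act _ _ _ _ _ _ = 0"

lemma shift_act_module:
  fixes e :: "complex \<Rightarrow> 'a::comm_ring_1"
  assumes e: "\<And>a b. e (a + b) = e a + e b" "\<And>a b. e (a * b) = e a * e b" "e 1 = 1" and lam: "lam \<noteq> 0"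
  shows "lie_module hv_scale hv_bracket (lie_module_on_type (\<lambda>c. Polynomial.smult (e c)) (\<lambda>u x. lin_ext (\<lambda>c. Polynomial.smult (e c)) (\<lambda>a. shift_act e lam \<beta> y a x) u))"
proof (rule lie_module_on_typeI)
  have e0: "e 0 = 0" using e(1)[of 0 0] by simp
  have em: "e (- a) = - e a" for a using e(1)[of a "-a"] by (simp add: e0 eq_neg_iff_add_eq_0 add.commute)
  have en: "e (of_nat k) = of_nat k" for k by (induction k) (auto simp: e e0)
  have ei: "e (of_int k) = of_int k" for k by (cases k) (simp_all add: em en e e0 del: of_nat_Suc)
  show vs: "vector_space (\<lambda>c. Polynomial.smult (e c))"
    by unfold_locales (simp_all add: e smult_add_right smult_add_left)
  show "shift_act e lam \<beta> y a (u + v) = shift_act e lam \<beta> y a u + shift_act e lam \<beta> y a v" for a u v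
    by (cases a) (simp_all add: pcompose_add algebra_simps smult_add_right)
  show "shift_act e lam \<beta> y a (Polynomial.smult (e c) u) = Polynomial.smult (e c) (shift_act e lam \<beta> y a u)" for a c u
    by (cases a) (simp_all add: pcompose_smult mult_ac)
  have P: "pcompose [:0,1:] [:of_int m, 1:] = [:0,1:] + of_int m" "pcompose [:y:] q = [:y:]" for m y and q :: "'a poly"
    by (simp_all add: pcompose_pCons of_int_poly)
  have Pi: "pcompose (of_int k) q = of_int k" for k and q :: "'a poly" by (simp add: of_int_poly pcompose_pCons)
  have sm: "Polynomial.smult c f = [:c:] * f" for c :: 'a and f by simp
  have lp: "[:e (lam powi (m + n)):] = [:e (lam powi m):] * [:e (lam powi n):]" for m n using lam by (simp add: power_int_add e)
  have cp: "[:of_int k:] = (of_int k :: 'a poly)" "[:- of_int k:] = (- of_int k :: 'a poly)" for k by (simp_all add: of_int_poly)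
  show "lin_ext (\<lambda>c. Polynomial.smult (e c)) (\<lambda>k. shift_act e lam \<beta> y k x) (hv_basis_bracket a b) = shift_act e lam \<beta> y a (shift_act e lam \<beta> y b x) - shift_act e lam \<beta> y b (shift_act e lam \<beta> y a x)" for a b x
  proof (cases a; cases b)
  qed (simp_all only: hv_basis_bracket.simps shift_act.simps lin_ext_add[OF vs] lin_ext_diff[OF vs] lin_ext_single[OF vs] lin_ext_zero[OF vs] if_distrib[of "lin_ext _ _"] smult_0_right if_cancel
    pcompose_0 pcompose_mult pcompose_add pcompose_smult P Pi shift_shift em ei sm lp cp mult_zero_right,
    simp_all only: add.commute[of m n for m n :: int], simp_all add: algebra_simps lp del: mult_pCons_left mult_pCons_right)
qed

lemma Psi_module: "lam \<noteq> 0 \<Longrightarrow> lie_module hv_scale hv_bracket (Psi lam \<beta>)"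
proof -
  have "scale_xy = (\<lambda>c. Polynomial.smult [:c:])" by (auto simp: scale_xy_def)
  moreover have "Psi_basis_act lam \<beta> a f = shift_act (\<lambda>c. [:c:]) lam \<beta> [:0,1:] a f" for a f
    by (cases a) (simp_all add: scale_xy_def)
  ultimately show "lam \<noteq> 0 \<Longrightarrow> ?thesis" unfolding Psi_def using shift_act_module[of "\<lambda>c. [:c:]"] by simp
qed

lemma Phi_module: "lam \<noteq> 0 \<Longrightarrow> lie_module hv_scale hv_bracket (Phi lam \<beta> b)"
proof -
  have "Phi_basis_act lam \<beta> b a f = shift_act (\<lambda>c. c) lam (poly \<beta> b) b a f" for a f
    by (cases a) simp_all
  then show "lam \<noteq> 0 \<Longrightarrow> ?thesis" unfolding Phi_def using shift_act_module[of "\<lambda>c. c"] by simp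
qed

lemma R_sub_lie_submodule:
  assumes "lam \<noteq> 0"
  shows "lie_submodule (R_sub g) (Psi lam \<beta>)"
proof -
  interpret lie_module hv_scale hv_bracket "Psi lam \<beta>" by (rule Psi_module[OF assms])
  have sm: "carrier (Psi lam \<beta>) = UNIV" "zero (Psi lam \<beta>) = 0" "add (Psi lam \<beta>) = (+)"
    "module.smult (Psi lam \<beta>) = scale_xy"
    "act (Psi lam \<beta>) = (\<lambda>u f. lin_ext scale_xy (\<lambda>a. Psi_basis_act lam \<beta> a f) u)"
    by (simp_all add: Psi_def lie_module_on_type_def)
  have vs: "vector_space scale_xy"
    by unfold_locales (auto simp: scale_xy_def smult_add_left[symmetric] smult_add_right mult.commute pCons_one)
  have R0: "0 \<in> R_sub g" by (auto simp: R_sub_def intro: exI[of _ 0])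
  have Radd: "p + q \<in> R_sub g" if "p \<in> R_sub g" "q \<in> R_sub g" for p q
    using that unfolding R_sub_def by (auto simp del: mult_pCons_left simp: distrib_left[symmetric])
  have Rmult: "h * p \<in> R_sub g" if "p \<in> R_sub g" for h p
    using that unfolding R_sub_def
    by (auto simp del: mult_pCons_left mult_pCons_right simp: mult.left_commute[of h])
  have Rneg: "- p \<in> R_sub g" if "p \<in> R_sub g" for p
    using Rmult[OF that, of "- 1"] by simp
  have Rscale: "scale_xy c p \<in> R_sub g" if "p \<in> R_sub g" for c p
    using Rmult[OF that, of "[:[:c:]:]"] by (simp add: scale_xy_def)
  have Rshift: "pcompose p q \<in> R_sub g" if "p \<in> R_sub g" for p q
    using that unfolding R_sub_def
    by (auto simp del: mult_pCons_left simp add: pcompose_mult pcompose_const)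
  have inv: "\<ominus>\<^bsub>Psi lam \<beta>\<^esub> p = - p" for p
  proof -
    have "(\<ominus>\<^bsub>Psi lam \<beta>\<^esub> p) + p = 0" using M.l_neg[of p] by (simp add: sm)
    then show ?thesis by (simp add: eq_neg_iff_add_eq_0)
  qed
  have "submodule (R_sub g) ring_of_type_algebra (Psi lam \<beta>)"
    by (rule submoduleI) (simp_all add: inv sm R0 Radd Rneg Rscale)
  moreover have "Psi_basis_act lam \<beta> a p \<in> R_sub g" if "p \<in> R_sub g" for a p
    using Rshift[OF that] by (cases a) (simp_all only: Psi_basis_act.simps Rscale Rmult R0)
  ultimately show ?thesis
    unfolding lie_submodule_def sm
    by (auto intro!: lin_ext_in[OF vs] R0 Radd Rscale)
qed

end

theory Submission
  imports Defs
begin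

text \<open>
  Elements of \<open>g'(y) \<complex>[x,y]\<close> have the form \<open>g'(y) f(x,y)\<close> with \<open>f\<close> unique, since \<open>g' \<noteq> 0\<close>.  The
  action on \<open>\<Psi>\<close> shifts \<open>x\<close> and multiplies by polynomials, so it is linear over \<open>\<complex>[y]\<close>
  (\<open>Psi_act_mult\<close>), and putting \<open>y = b\<close> turns it into the action on \<open>\<Phi>\<close> (\<open>eval_y_act\<close>).  Hence
  \<open>g'(y) f(x,y) \<mapsto> f(x,b)\<close> is a homomorphism onto \<open>\<Phi>\<close>.  Its kernel consists of the \<open>g' f\<close> with
  \<open>f\<close> divisible by \<open>y - b\<close>, that is, of the multiples of \<open>(y - b) g' = g\<close>; the first isomorphism
  theorem (\<open>lie_first_isomorphism\<close>) gives the isomorphism.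

  Irreducibility passes through isomorphisms (\<open>lie_irreducible_isomorphic\<close>), so it is enough to treat
  \<open>\<Phi>\<close> (\<open>Phi_irreducible\<close>).  As \<open>L\<^sub>0\<close> is multiplication by \<open>x\<close>, a submodule of \<open>\<Phi>\<close> is an ideal of
  \<open>\<complex>[x]\<close>.  If it is neither zero nor everything, then its elements have a common root \<open>r\<close>, and it
  contains some \<open>p \<noteq> 0\<close>.  Evaluating \<open>L\<^sub>m p\<close> and \<open>H\<^sub>m p\<close> at \<open>r\<close> shows
  \<open>(r + m \<beta>(b)) p(r + m) = 0\<close> and \<open>b p(r + m) = 0\<close> for all \<open>m\<close>.  When \<open>b\<close> and \<open>\<beta>(b)\<close> are not both
  zero, this makes \<open>p\<close> vanish at \<open>r + m\<close> for all \<open>m\<close> with at most one exception, which is absurd.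
\<close>

section \<open>Lie modules along bijections, submodules and quotients\<close>

lemma lie_module_group_hom:
  assumes "lie_module scale bracket M" "lie_module scale bracket M'"
    and "h \<in> hom (add_monoid M) (add_monoid M')"
  shows "abelian_group_hom M M' h"
proof -
  interpret M: lie_module scale bracket M by fact
  interpret M': lie_module scale bracket M' by fact
  show ?thesis
    by (intro abelian_group_homI group_hom.intro group_hom_axioms.intro assms(3)
        M.abelian_group_axioms M'.abelian_group_axioms M.a_group M'.a_group)
qed

text \<open>
  Apart from closure, the axioms on scalars and on the action are equations between elements of \<open>Q\<close>; as
  \<open>F\<close> is injective, each follows from the same equation in \<open>M'\<close>.  The quotient by the kernel of
  a homomorphism is shown to be a Lie module in this way, without computing with cosets.
\<close>

lemma lie_module_transport:
  assumes M': "lie_module scale bracket M'" and Q: "abelian_group Q"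
    and F: "F \<in> lie_module_iso Q M'"
    and sc: "\<And>c x. x \<in> carrier Q \<Longrightarrow> c \<odot>\<^bsub>Q\<^esub> x \<in> carrier Q"
    and ac: "\<And>u x. x \<in> carrier Q \<Longrightarrow> act Q u x \<in> carrier Q"
  shows "lie_module scale bracket Q"
proof -
  interpret M': lie_module scale bracket M' by fact
  interpret Q: abelian_group Q by fact
  from F have hom: "F \<in> hom (add_monoid Q) (add_monoid M')"
    and bij: "bij_betw F (carrier Q) (carrier M')"
    and Fs: "\<And>c x. x \<in> carrier Q \<Longrightarrow> F (c \<odot>\<^bsub>Q\<^esub> x) = c \<odot>\<^bsub>M'\<^esub> F x"
    and Fa: "\<And>u x. x \<in> carrier Q \<Longrightarrow> F (act Q u x) = act M' u (F x)"
    by (auto simp: lie_module_iso_def iso_def)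
  interpret F: abelian_group_hom Q M' F
    by (intro abelian_group_homI group_hom.intro group_hom_axioms.intro hom
        Q.abelian_group_axioms M'.abelian_group_axioms Q.a_group M'.a_group)
  have Fm: "F (x \<ominus>\<^bsub>Q\<^esub> y) = F x \<ominus>\<^bsub>M'\<^esub> F y" if "x \<in> carrier Q" "y \<in> carrier Q" for x y
    using that by (simp add: a_minus_def)
  have inj: "x = y" if "x \<in> carrier Q" "y \<in> carrier Q" "F x = F y" for x y
    using bij that by (auto simp: bij_betw_def inj_on_def)
  have rc: "c \<in> carrier (ring_of_type_algebra :: 'a ring)" for c
    by (simp add: ring_of_type_algebra_def)
  have ro: "c \<otimes>\<^bsub>(ring_of_type_algebra :: 'a ring)\<^esub> d = c * d"
      "c \<oplus>\<^bsub>(ring_of_type_algebra :: 'a ring)\<^esub> d = c + d"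
      "\<one>\<^bsub>(ring_of_type_algebra :: 'a ring)\<^esub> = 1" for c d
    by (simp_all add: ring_of_type_algebra_def)
  note M's = M'.smult_l_distr[OF rc rc, unfolded ro] M'.smult_r_distr[OF rc]
    M'.smult_assoc1[OF rc rc, unfolded ro] M'.smult_one[unfolded ro]
  have mod: "Module.module (ring_of_type_algebra :: 'a ring) Q"
    by (rule Module.moduleI[OF M'.R.is_cring Q])
       (auto intro!: inj intro: sc simp: Fs sc M's ro)
  show ?thesis
    by (intro lie_module.intro M'.lie_algebra_axioms mod lie_module_axioms.intro)
       (auto intro!: inj intro: sc ac
        simp: Fs Fa Fm sc ac M'.act_add_right M'.act_smult_right M'.act_add_left
          M'.act_scale_left M'.act_bracket)
qed

lemma lie_submodule_lie_module:
  assumes M: "lie_module scale bracket M" and N: "lie_submodule N M"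
  shows "lie_module scale bracket (M\<lparr>carrier := N\<rparr>)"
proof -
  interpret M: lie_module scale bracket M by fact
  interpret N: submodule N "ring_of_type_algebra :: 'a ring" M
    using N by (simp add: lie_submodule_def)
  have act: "act M u x \<in> N" if "x \<in> N" for u x
    using N that by (simp add: lie_submodule_def)
  have sub: "x \<in> carrier M" if "x \<in> N" for x
    using N.subset that by auto
  \<comment> \<open>Negation is defined through the carrier, so its value in the submodule has to be compared with
    the one in \<open>M\<close>.\<close>
  have "a_inv (M\<lparr>carrier := N\<rparr>) y = a_inv M y" if "y \<in> N" for y
    using group.m_inv_consistent[OF M.a_group N.subgroup_axioms that]
    by (simp add: a_inv_def)
  then have minus: "x \<ominus>\<^bsub>M\<lparr>carrier := N\<rparr>\<^esub> y = x \<ominus>\<^bsub>M\<^esub> y" if "y \<in> N" for x y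
    using that by (simp add: a_minus_def)
  show ?thesis
    by (intro lie_module.intro M.lie_algebra_axioms lie_module_axioms.intro
        N.submodule_is_module[OF M.module_axioms])
       (auto simp: act sub minus M.act_add_right M.act_smult_right M.act_add_left
          M.act_scale_left M.act_bracket)
qed

text \<open>
  The group isomorphism from the quotient is the one of the first isomorphism theorem for abelian groups.
  The cosets of the kernel are the fibres of \<open>h\<close>, and scalars and the Lie algebra map fibres into
  fibres; this makes the operations on cosets independent of representatives.
\<close>

lemma lie_first_isomorphism:
  assumes M: "lie_module scale bracket M" and M': "lie_module scale bracket M'"
    and h: "h \<in> hom (add_monoid M) (add_monoid M')"
    and hs: "\<And>c x. x \<in> carrier M \<Longrightarrow> h (c \<odot>\<^bsub>M\<^esub> x) = c \<odot>\<^bsub>M'\<^esub> h x"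
    and ha: "\<And>u x. x \<in> carrier M \<Longrightarrow> h (act M u x) = act M' u (h x)"
    and onto: "h ` carrier M = carrier M'"
    and ker: "{x \<in> carrier M. h x = \<zero>\<^bsub>M'\<^esub>} = N"
  shows "lie_isomorphic scale bracket (lie_quotient M N) M'"
proof -
  interpret M: lie_module scale bracket M by fact
  interpret M': lie_module scale bracket M' by fact
  interpret h: abelian_group_hom M M' h by (rule lie_module_group_hom[OF M M' h])
  have N: "N = a_kernel M M' h"
    unfolding ker[symmetric] a_kernel_def' ..
  interpret N: abelian_subgroup N M
    unfolding N by (rule h.abelian_subgroup_a_kernel)
  let ?Q = "lie_quotient M N"
  have Q_ops: "carrier ?Q = carrier (M A_Mod N)" "add ?Q = monoid.mult (M A_Mod N)"
      "\<zero>\<^bsub>?Q\<^esub> = \<one>\<^bsub>M A_Mod N\<^esub>"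
    by (simp_all add: lie_quotient_def A_FactGroup_def FactGroup_def A_RCOSETS_def set_add_def)
  interpret quotient_group: comm_group "M A_Mod N"
    by (rule N.a_factorgroup_is_comm_group)
  have Q: "abelian_group ?Q"
    by (rule abelian_groupI, unfold Q_ops)
       (assumption | rule quotient_group.m_closed quotient_group.one_closed quotient_group.m_assoc
         quotient_group.m_comm quotient_group.l_one quotient_group.l_inv_ex)+
  let ?F = "\<lambda>A. the_elem (h ` A)"
  have "?F \<in> iso (M A_Mod N) (add_monoid M')"
    unfolding N by (rule h.A_FactGroup_iso_set[OF onto])
  then have iso: "?F \<in> iso (add_monoid ?Q) (add_monoid M')"
    by (simp add: iso_def hom_def Q_ops)
  have rep: "\<exists>x\<in>carrier M. A = N +>\<^bsub>M\<^esub> x" if "A \<in> carrier ?Q" for A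
    using that by (auto simp: lie_quotient_def A_RCOSETS_def')
  have cos: "N +>\<^bsub>M\<^esub> x \<in> carrier ?Q" if "x \<in> carrier M" for x
    using that by (auto simp: lie_quotient_def A_RCOSETS_def')
  have h_const: "h y = h x" if x: "x \<in> carrier M" and y: "y \<in> N +>\<^bsub>M\<^esub> x" for x y
  proof -
    obtain n where n: "n \<in> N" "y = n \<oplus>\<^bsub>M\<^esub> x"
      using y unfolding a_r_coset_def' by blast
    then have "n \<in> carrier M" "h n = \<zero>\<^bsub>M'\<^esub>"
      using ker by blast+
    then show ?thesis
      unfolding n(2) h.hom_add[OF \<open>n \<in> carrier M\<close> x]
      using M'.l_zero[OF h.hom_closed[OF x]] \<open>h n = \<zero>\<^bsub>M'\<^esub>\<close> by simp
  qed
  have self: "x \<in> N +>\<^bsub>M\<^esub> x" if "x \<in> carrier M" for x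
    using that by (rule N.a_rcos_self)
  have F: "?F (N +>\<^bsub>M\<^esub> x) = h x" if "x \<in> carrier M" for x
  proof -
    have "h ` (N +>\<^bsub>M\<^esub> x) = {h x}" using h_const[OF that] self[OF that] by blast
    then show ?thesis by simp
  qed
  have cos_eq: "N +>\<^bsub>M\<^esub> x = N +>\<^bsub>M\<^esub> y"
    if "x \<in> carrier M" "y \<in> carrier M" "h x = h y" for x y
    using iso cos[OF that(1)] cos[OF that(2)] F[OF that(1)] F[OF that(2)] that(3)
    by (auto simp: iso_def bij_betw_def inj_on_def)
  have in_M: "y \<in> carrier M" if "x \<in> carrier M" "y \<in> N +>\<^bsub>M\<^esub> x" for x y
    using that N.a_subset by (auto simp: a_r_coset_def')
  \<comment> \<open>An operation \<open>k\<close> on \<open>M\<close> covering an operation \<open>k'\<close> on \<open>M'\<close> descends to cosets; this serves both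
    scalars and the action.\<close>
  have op: "(\<Union>y\<in>N +>\<^bsub>M\<^esub> x. N +>\<^bsub>M\<^esub> k y) = N +>\<^bsub>M\<^esub> k x"
    if x: "x \<in> carrier M" and k: "\<And>y. y \<in> carrier M \<Longrightarrow> k y \<in> carrier M"
      "\<And>y. y \<in> carrier M \<Longrightarrow> h (k y) = k' (h y)" for x k k'
  proof -
    have "N +>\<^bsub>M\<^esub> k y = N +>\<^bsub>M\<^esub> k x" if "y \<in> N +>\<^bsub>M\<^esub> x" for y
      using cos_eq[of "k y" "k x"] k x in_M[OF x that] h_const[OF x that] by simp
    then show ?thesis using self[OF x] by blast
  qed
  have rc: "c \<in> carrier (ring_of_type_algebra :: 'a ring)" for c
    by (simp add: ring_of_type_algebra_def)
  have smult_Q: "c \<odot>\<^bsub>?Q\<^esub> (N +>\<^bsub>M\<^esub> x) = N +>\<^bsub>M\<^esub> (c \<odot>\<^bsub>M\<^esub> x)" if "x \<in> carrier M" for c x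
    using op[OF that, of "\<lambda>y. c \<odot>\<^bsub>M\<^esub> y" "\<lambda>y. c \<odot>\<^bsub>M'\<^esub> y"] M.smult_closed[OF rc] hs
    by (simp add: lie_quotient_def)
  have act_Q: "act ?Q u (N +>\<^bsub>M\<^esub> x) = N +>\<^bsub>M\<^esub> act M u x" if "x \<in> carrier M" for u x
    using op[OF that, of "act M u" "act M' u"] M.act_closed ha
    by (simp add: lie_quotient_def)
  have F_iso: "?F \<in> lie_module_iso ?Q M'"
    unfolding lie_module_iso_def
    using iso by (auto dest!: rep simp: smult_Q act_Q F M.smult_closed[OF rc] M.act_closed hs ha)
  have "lie_module scale bracket ?Q"
    by (rule lie_module_transport[OF M' Q F_iso])
       (auto dest!: rep intro!: cos simp: smult_Q act_Q M.smult_closed[OF rc] M.act_closed)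
  then show ?thesis
    using M' F_iso by (auto simp: lie_isomorphic_def)
qed

lemma lie_irreducible_isomorphic:
  assumes iso: "lie_isomorphic scale bracket M M'" and irr: "lie_irreducible scale bracket M'"
  shows "lie_irreducible scale bracket M"
proof -
  have M: "lie_module scale bracket M" and M': "lie_module scale bracket M'"
    using iso by (auto simp: lie_isomorphic_def)
  interpret M: lie_module scale bracket M by fact
  interpret M': lie_module scale bracket M' by fact
  obtain F where F: "F \<in> lie_module_iso M M'"
    using iso by (auto simp: lie_isomorphic_def)
  then have hom: "F \<in> hom (add_monoid M) (add_monoid M')"
    and inj: "inj_on F (carrier M)" and onto: "F ` carrier M = carrier M'"
    and Fs: "\<And>c x. x \<in> carrier M \<Longrightarrow> F (c \<odot>\<^bsub>M\<^esub> x) = c \<odot>\<^bsub>M'\<^esub> F x"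
    and Fa: "\<And>u x. x \<in> carrier M \<Longrightarrow> F (act M u x) = act M' u (F x)"
    by (auto simp: lie_module_iso_def iso_def bij_betw_def)
  interpret F: abelian_group_hom M M' F by (rule lie_module_group_hom[OF M M' hom])
  have zero: "F ` {\<zero>\<^bsub>M\<^esub>} = {\<zero>\<^bsub>M'\<^esub>}" by simp
  have "N = {\<zero>\<^bsub>M\<^esub>} \<or> N = carrier M" if N: "lie_submodule N M" for N
  proof -
    interpret N: submodule N "ring_of_type_algebra :: 'a ring" M
      using N by (simp add: lie_submodule_def)
    have sub: "N \<subseteq> carrier M" using N.subset by simp
    have "subgroup (F ` N) (add_monoid M')"
      by (rule group_hom.subgroup_img_is_subgroup[OF F.a_group_hom N.subgroup_axioms])
    moreover have "c \<odot>\<^bsub>M'\<^esub> y \<in> F ` N" if "y \<in> F ` N" for c y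
    proof -
      from that obtain x where x: "x \<in> N" "y = F x" by blast
      have "c \<odot>\<^bsub>M\<^esub> x \<in> N"
        using N.smult_closed[of c x] x by (simp add: ring_of_type_algebra_def)
      then show ?thesis
        using Fs[of x c] x sub by (metis image_eqI subsetD)
    qed
    moreover have "act M' u y \<in> F ` N" if "y \<in> F ` N" for u y
    proof -
      from that obtain x where x: "x \<in> N" "y = F x" by blast
      have "act M u x \<in> N" using N x by (simp add: lie_submodule_def)
      then show ?thesis
        using Fa[of x u] x sub by (metis image_eqI subsetD)
    qed
    ultimately have "lie_submodule (F ` N) M'"
      by (simp add: lie_submodule_def submodule_def submodule_axioms_def)
    then have "F ` N = F ` {\<zero>\<^bsub>M\<^esub>} \<or> F ` N = F ` carrier M"
      using irr unfolding zero onto by (simp add: lie_irreducible_def)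
    then show ?thesis
      using inj_on_image_eq_iff[OF inj sub] by (metis M.zero_closed empty_subsetI insert_subset order_refl)
  qed
  moreover have "carrier M \<noteq> {\<zero>\<^bsub>M\<^esub>}"
    using irr zero onto by (auto simp: lie_irreducible_def)
  ultimately show ?thesis
    using M by (auto simp: lie_irreducible_def)
qed

section \<open>Irreducibility of \<open>\<Phi>\<close>\<close>

lemma Phi_simps:
  "carrier (Phi lam \<beta> b) = UNIV" "zero (Phi lam \<beta> b) = 0" "add (Phi lam \<beta> b) = (+)"
  "module.smult (Phi lam \<beta> b) = Polynomial.smult"
  "act (Phi lam \<beta> b) u f = lin_ext Polynomial.smult (\<lambda>a. Phi_basis_act lam \<beta> b a f) u"
  by (simp_all add: Phi_def lie_module_on_type_def)

lemma vector_space_smult: "vector_space (Polynomial.smult :: complex \<Rightarrow> _)"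
  by unfold_locales (simp_all add: smult_add_left smult_add_right)

text \<open>
  \<open>\<complex>[x]\<close> is a principal ideal domain, and over \<open>\<complex>\<close> a generator of a proper ideal has a root.  The
  generator \<open>p\<close> found in the third case is a nonzero element of least degree.
\<close>

lemma complex_poly_ideal_cases:
  fixes N :: "complex poly set"
  assumes zero: "0 \<in> N" and add: "\<And>p q. p \<in> N \<Longrightarrow> q \<in> N \<Longrightarrow> p + q \<in> N"
    and mult: "\<And>h p. p \<in> N \<Longrightarrow> h * p \<in> N"
  obtains "N = {0}" | "N = UNIV" | p r where "p \<in> N" "p \<noteq> 0" "\<And>f. f \<in> N \<Longrightarrow> poly f r = 0"
proof (cases "N = {0}")
  case False
  with zero have "\<exists>p. p \<in> N \<and> p \<noteq> 0" by blast
  then obtain p where p: "p \<in> N" "p \<noteq> 0"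
    and min: "\<And>q. q \<in> N \<Longrightarrow> q \<noteq> 0 \<Longrightarrow> degree p \<le> degree q"
    using ex_has_least_nat[of "\<lambda>p. p \<in> N \<and> p \<noteq> 0" _ degree] by blast
  have dvd: "p dvd f" if "f \<in> N" for f
  proof -
    have "f mod p = f + (- (f div p)) * p" by (simp add: minus_div_mult_eq_mod [symmetric])
    then have "f mod p \<in> N" using add[OF that mult[OF p(1)]] by metis
    moreover have "f mod p = 0 \<or> degree (f mod p) < degree p"
      using degree_mod_less[OF p(2)] by blast
    ultimately have "f mod p = 0" using min[of "f mod p"] by linarith
    then show ?thesis by (simp add: mod_eq_0_iff_dvd)
  qed
  show ?thesis
  proof (cases "degree p = 0")
    case True
    then have "p dvd 1" using p(2) by (simp add: is_unit_iff_degree)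
    then obtain k where "1 = p * k" by (rule dvdE)
    then have "1 \<in> N" using mult[OF p(1), of k] by (simp add: mult.commute)
    then have "N = UNIV" using mult[of 1] by auto
    then show ?thesis by (rule that)
  next
    case False
    then have "\<not> constant (poly p)" by (simp add: constant_degree)
    then obtain r where "poly p r = 0" using fundamental_theorem_of_algebra by blast
    then show ?thesis using that(3)[OF p] dvd by (metis dvdE mult_zero_left poly_mult)
  qed
qed (rule that)

text \<open>
  A submodule is an ideal, because \<open>L\<^sub>0\<close> acts as \<open>x\<close>.  A common root \<open>r\<close> of its elements would be
  carried by \<open>L\<^sub>m\<close> and \<open>H\<^sub>m\<close> to infinitely many roots of one of them.
\<close>

lemma Phi_irreducible:
  assumes lam: "lam \<noteq> 0" and b: "(b, poly \<beta> b) \<noteq> (0, 0)"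
  shows "hv_irreducible (Phi lam \<beta> b)"
proof -
  have "N = {0} \<or> N = UNIV" if N: "lie_submodule N (Phi lam \<beta> b)" for N
  proof -
    interpret N: submodule N "ring_of_type_algebra :: complex ring" "Phi lam \<beta> b"
      using N by (simp add: lie_submodule_def)
    have zero: "0 \<in> N" using N.one_closed by (simp add: Phi_simps)
    have add: "p + q \<in> N" if "p \<in> N" "q \<in> N" for p q
      using N.m_closed[of p q] that by (simp add: Phi_simps)
    have scale: "Polynomial.smult c p \<in> N" if "p \<in> N" for c p
      using N.smult_closed[of c p] that by (simp add: Phi_simps ring_of_type_algebra_def)
    have basis: "Phi_basis_act lam \<beta> b a p \<in> N" if "p \<in> N" for a p
    proof -
      have "act (Phi lam \<beta> b) (Poly_Mapping.single a 1) p \<in> N"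
        using N that by (simp add: lie_submodule_def)
      then show ?thesis by (simp add: Phi_simps lin_ext_single[OF vector_space_smult])
    qed
    have X: "[:0, 1:] * p \<in> N" if "p \<in> N" for p
      using basis[OF that, of "hv_L 0"] by simp
    have mult: "h * p \<in> N" if "p \<in> N" for h p
    proof (induction h)
      case 0
      then show ?case by (simp add: zero)
    next
      case (pCons a h)
      have "pCons a h * p = Polynomial.smult a p + [:0, 1:] * (h * p)" by simp
      then show ?case using add[OF scale[OF that, of a] X[OF pCons.IH]] by simp
    qed
    show ?thesis
    proof (rule complex_poly_ideal_cases[of N, OF zero add mult])
      fix p r assume p: "p \<in> N" "p \<noteq> 0" and r: "\<And>f. f \<in> N \<Longrightarrow> poly f r = 0"
      have L: "(r + of_int m * poly \<beta> b) * poly p (r + of_int m) = 0" for m :: int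
      proof -
        have "poly (Phi_basis_act lam \<beta> b (hv_L m) p) r =
            lam powi m * ((r + of_int m * poly \<beta> b) * poly p (r + of_int m))"
          by (simp add: poly_pcompose of_int_poly algebra_simps)
        then show ?thesis using r[OF basis[OF p(1), of "hv_L m"]] lam by simp
      qed
      have H: "b * poly p (r + of_int m) = 0" for m :: int
        using r[OF basis[OF p(1), of "hv_H m"]] lam
        by (simp add: poly_pcompose add_ac)
      \<comment> \<open>If \<open>b \<noteq> 0\<close>, then \<open>H\<close> leaves no exception.  If \<open>b = 0\<close>, then \<open>\<beta>(b) \<noteq> 0\<close>, and the exception \<open>k\<close> is the
        \<open>m\<close> with \<open>r + m \<beta>(b) = 0\<close>, of which there is at most one.\<close>
      have "\<exists>k. \<forall>m :: int. m \<noteq> k \<longrightarrow> poly p (r + of_int m) = 0"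
      proof (rule ccontr)
        assume *: "\<not> ?thesis"
        then obtain m where m: "poly p (r + of_int m) \<noteq> 0" by blast
        from * obtain n where n: "n \<noteq> m" "poly p (r + of_int n) \<noteq> 0" by blast
        have "b = 0" using H[of m] m by simp
        moreover have "poly \<beta> b = 0"
        proof -
          have "of_int (m - n) * poly \<beta> b = (r + of_int m * poly \<beta> b) - (r + of_int n * poly \<beta> b)"
            by (simp add: algebra_simps)
          also have "\<dots> = 0" using L[of m] L[of n] m n by simp
          finally show ?thesis using n by simp
        qed
        ultimately show False using b by simp
      qed
      then obtain k where k: "\<And>m :: int. m \<noteq> k \<Longrightarrow> poly p (r + of_int m) = 0" by blast
      have "infinite ((\<lambda>m :: int. r + of_int m) ` (UNIV - {k}))"
        by (subst finite_image_iff) (auto simp: inj_on_def infinite_UNIV_int)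
      moreover have "(\<lambda>m :: int. r + of_int m) ` (UNIV - {k}) \<subseteq> {x. poly p x = 0}"
        using k by auto
      ultimately have False using poly_roots_finite[OF p(2)] finite_subset by blast
      then show ?thesis ..
    qed auto
  qed
  moreover have "(UNIV :: complex poly set) \<noteq> {0}" by (metis UNIV_I singletonD zero_neq_one)
  ultimately show ?thesis
    using Phi_module[OF lam] by (simp add: lie_irreducible_def Phi_simps)
qed

section \<open>Specialisation at \<open>y = b\<close>\<close>

lemma Psi_simps:
  "carrier (Psi lam \<beta>) = UNIV" "zero (Psi lam \<beta>) = 0" "add (Psi lam \<beta>) = (+)"
  "module.smult (Psi lam \<beta>) = scale_xy"
  "act (Psi lam \<beta>) u f = lin_ext scale_xy (\<lambda>a. Psi_basis_act lam \<beta> a f) u"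
  by (simp_all add: Psi_def lie_module_on_type_def)

lemma lin_ext_comp:
  assumes "T 0 = 0" "\<And>x y. T (x + y) = T x + T y" "\<And>c x. T (s c x) = s' c (T x)"
  shows "T (lin_ext s f u) = lin_ext s' (\<lambda>a. T (f a)) u"
  using sum_comp_morphism[of T "\<lambda>a. s (Poly_Mapping.lookup u a) (f a)" "Poly_Mapping.keys u"] assms
  by (simp add: lin_ext_def o_def)

text \<open>The action is linear over \<open>\<complex>[y]\<close>, as the shifts \<open>x \<mapsto> x + m\<close> fix \<open>y\<close>.\<close>

lemma Psi_act_mult:
  "act (Psi lam \<beta>) u ([:q:] * f) = [:q:] * act (Psi lam \<beta>) u f"
proof -
  have "Psi_basis_act lam \<beta> a ([:q:] * f) = [:q:] * Psi_basis_act lam \<beta> a f" for a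
    by (cases a) (simp_all add: scale_xy_def pcompose_mult pcompose_smult mult_ac smult_add_right)
  then show ?thesis
    unfolding Psi_simps
    by (subst lin_ext_comp[where T = "\<lambda>f. [:q:] * f" and s' = scale_xy])
       (simp_all add: distrib_left scale_xy_def mult_ac smult_add_right)
qed

definition eval_y :: "complex \<Rightarrow> complex poly poly \<Rightarrow> complex poly" where
  "eval_y b = map_poly (\<lambda>q. poly q b)"

lemma coeff_eval_y: "coeff (eval_y b f) n = poly (coeff f n) b"
  by (simp add: eval_y_def coeff_map_poly)

lemma poly_eval_y: "poly (eval_y b f) x = poly (poly f [:x:]) b"
  by (induction f) (simp_all add: eval_y_def map_poly_pCons)

lemma eval_y_hom:
  "eval_y b 0 = 0" "eval_y b (f + h) = eval_y b f + eval_y b h"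
  "eval_y b (scale_xy c f) = Polynomial.smult c (eval_y b f)"
  by (simp_all add: poly_eq_iff coeff_eval_y scale_xy_def)

text \<open>
  A polynomial is determined by its values, and \<open>eval_y b f\<close> takes the value \<open>f(x,b)\<close> at \<open>x\<close>; for basis
  elements the claim thus becomes an identity between complex numbers.
\<close>

lemma eval_y_act:
  "eval_y b (act (Psi lam \<beta>) u f) = act (Phi lam \<beta> b) u (eval_y b f)"
proof -
  have "eval_y b (Psi_basis_act lam \<beta> a f) = Phi_basis_act lam \<beta> b a (eval_y b f)" for a
    by (cases a)
       (simp_all add: poly_eq_poly_eq_iff[symmetric] fun_eq_iff poly_eval_y scale_xy_def
         poly_pcompose of_int_poly)
  then show ?thesis
    unfolding Psi_simps Phi_simps
    by (subst lin_ext_comp[where T = "eval_y b" and s' = Polynomial.smult])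
       (simp_all add: eval_y_hom)
qed

lemma eval_y_eq_0_iff: "eval_y b f = 0 \<longleftrightarrow> [:[:- b, 1:]:] dvd f"
  by (simp add: poly_eq_iff coeff_eval_y const_poly_dvd_iff poly_eq_0_iff_dvd)

lemma surj_eval_y: "surj (eval_y b)"
proof (rule surjI)
  show "eval_y b (map_poly (\<lambda>c. [:c:]) q) = q" for q
    by (simp add: poly_eq_iff coeff_eval_y coeff_map_poly)
qed

lemma quotient_isomorphic_Phi:
  assumes lam: "lam \<noteq> 0" and g: "g = [:- b, 1:] * g'" and g': "g' \<noteq> 0"
  shows "hv_isomorphic (lie_quotient (Psi_sub lam \<beta> g') (R_sub g)) (Phi lam \<beta> b)"
proof -
  \<comment> \<open>The division is exact on \<open>R_sub g'\<close>, so there \<open>h\<close> is the map \<open>g'(y) f(x,y) \<mapsto> f(x,b)\<close>.\<close>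
  define h where "h p = eval_y b (p div [:g':])" for p
  have h: "h ([:g':] * f) = eval_y b f" for f
    using g' by (simp add: h_def del: mult_pCons_left)
  have R: "R_sub g' = range ((*) [:g':])"
    by (auto simp: R_sub_def)
  have scale: "scale_xy c ([:g':] * f) = [:g':] * scale_xy c f" for c f
    by (simp add: scale_xy_def mult.commute)
  show ?thesis
  proof (rule lie_first_isomorphism)
    show "lie_module hv_scale hv_bracket (Psi_sub lam \<beta> g')"
      unfolding Psi_sub_def
      by (rule lie_submodule_lie_module[OF Psi_module R_sub_lie_submodule]) (fact lam)+
    show "lie_module hv_scale hv_bracket (Phi lam \<beta> b)"
      by (rule Phi_module[OF lam])
    show "h \<in> hom (add_monoid (Psi_sub lam \<beta> g')) (add_monoid (Phi lam \<beta> b))"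
      by (auto simp: hom_def Psi_sub_def Psi_simps Phi_simps R h eval_y_hom
          distrib_left[symmetric] simp del: mult_pCons_left)
    show "h (c \<odot>\<^bsub>Psi_sub lam \<beta> g'\<^esub> p) = c \<odot>\<^bsub>Phi lam \<beta> b\<^esub> h p"
      if "p \<in> carrier (Psi_sub lam \<beta> g')" for c p
      using that by (auto simp: Psi_sub_def Psi_simps Phi_simps R scale h eval_y_hom
          simp del: mult_pCons_left)
    show "h (act (Psi_sub lam \<beta> g') u p) = act (Phi lam \<beta> b) u (h p)"
      if "p \<in> carrier (Psi_sub lam \<beta> g')" for u p
      using that by (auto simp: Psi_sub_def R Psi_act_mult h eval_y_act
          simp del: mult_pCons_left)
    show "h ` carrier (Psi_sub lam \<beta> g') = carrier (Phi lam \<beta> b)"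
      using surj_eval_y[of b]
      by (simp add: Psi_sub_def Phi_simps R image_image h del: mult_pCons_left)
    have "{p \<in> carrier (Psi_sub lam \<beta> g'). h p = \<zero>\<^bsub>Phi lam \<beta> b\<^esub>} =
        (*) [:g':] ` {f. [:[:- b, 1:]:] dvd f}"
      by (auto simp: Psi_sub_def Phi_simps R h eval_y_eq_0_iff simp del: mult_pCons_left)
    also have "{f. [:[:- b, 1:]:] dvd f} = range ((*) [:[:- b, 1:]:])"
      by (auto simp: dvd_def)
    also have "(*) [:g':] ` range ((*) [:[:- b, 1:]:]) = range ((*) [:g:])"
    proof -
      have "[:g':] * [:[:- b, 1:]:] = [:g:]"
        by (simp add: g mult.commute)
      then show ?thesis
        by (simp only: image_image mult.assoc[symmetric])
    qed
    also have "\<dots> = R_sub g"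
      by (auto simp: R_sub_def)
    finally show "{p \<in> carrier (Psi_sub lam \<beta> g'). h p = \<zero>\<^bsub>Phi lam \<beta> b\<^esub>} = R_sub g" .
  qed
qed

theorem proposition5p3:
  fixes lam b :: complex and \<beta> g g' :: "complex poly"
  assumes "lam \<noteq> 0"
    and "g = [:- b, 1:] * g'"
    and "g' \<noteq> 0"
  shows "hv_isomorphic (lie_quotient (Psi_sub lam \<beta> g') (R_sub g)) (Phi lam \<beta> b) \<and>
    ((b, poly \<beta> b) \<noteq> (0, 0) \<longrightarrow>
      hv_irreducible (lie_quotient (Psi_sub lam \<beta> g') (R_sub g)))"
proof (intro conjI impI)
  show iso: "hv_isomorphic (lie_quotient (Psi_sub lam \<beta> g') (R_sub g)) (Phi lam \<beta> b)"
    by (rule quotient_isomorphic_Phi[OF assms])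
  show "hv_irreducible (lie_quotient (Psi_sub lam \<beta> g') (R_sub g))"
    if "(b, poly \<beta> b) \<noteq> (0, 0)"
    by (rule lie_irreducible_isomorphic[OF iso Phi_irreducible[OF assms(1) that]])
qed

end
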